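(* In the Kullback–Leibler optimal control setting described in the context, fix a state $x^\circ\in\mathsf{X}$. There exist optimizers $\{\check\pi_\zeta,\check P_\zeta:\zeta\in\mathbb{R}\}$ of $$\max_{\pi,P}\bigl\{\zeta\pi(\mathcal{U})-K(P\|P_0)\,:\,\pi P=\pi\bigr\}$$ (the maximum being over pmfs $\pi$ on $\mathsf{X}$ and transition matrices of the form $P(x,x')=R(x,x_u')Q_0(x,x_n')$), and solutions $\{h^*_\zeta,\eta^*_\zeta:\zeta\in\mathbb{R}\}$, $h^*_\zeta(x^\circ)=0$, to the average reward optimality equation $$\max_R\Bigl\{w_\zeta(x,R)+\sum_{x'}P(x,x')h^*_\zeta(x')\Bigr\}=h^*_\zeta(x)+\eta^*_\zeta,\qquad x\in\mathsf{X},$$ with the following properties: (i) The optimizer $\check P_\zeta$ can be obtained from the relative value function $h^*_\zeta$ as follows: $$\check P_\zeta(x,x')=P_0(x,x')\exp\bigl(h_\zeta(x_u'\mid x)-\Lambda_{h_\zeta}(x)\bigr),$$ where for $x\in\mathsf{X}$, $x_u'\in\mathsf{X}_u$, $$h_\zeta(x_u'\mid x)=\sum_{x_n'}Q_0(x,x_n')h^*_\zeta(x_u',x_n'),$$ and $\Lambda_{h_\zeta}(x)=\log\Bigl(\sum_{x'}P_0(x,x')\exp\bigl(h_\zeta(x_u'\mid x)\bigr)\Bigr)$ is the normalizing constant. (ii) $\{\check\pi_\zeta,\check P_\zeta,h^*_\zeta,\eta^*_\zeta:\zeta\in\mathbb{R}\}$ are continuously differentiable in the parameter $\zeta$.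
   Context: The state space is a product of two finite sets, $\mathsf{X}=\mathsf{X}_u\times\mathsf{X}_n$, with elements $x=(x_u,x_n)$. A matrix $Q_0(x,x_n')\ge 0$ with $\sum_{x_n'}Q_0(x,x_n')=1$ for each $x\in\mathsf{X}$ is fixed ("nature"). All transition matrices $P$ on $\mathsf{X}$ under consideration have the form $$P(x,x')=R(x,x_u')\,Q_0(x,x_n'),\qquad x\in\mathsf{X},\ x'=(x_u',x_n')\in\mathsf{X},$$ with $R(x,x_u')\ge0$ and $\sum_{x_u'}R(x,x_u')=1$ for each $x$. The nominal transition matrix $P_0(x,x')=R_0(x,x_u')Q_0(x,x_n')$ also has this form and is irreducible and aperiodic. A function $\mathcal{U}:\mathsf{X}\to\mathbb{R}$ is fixed, and $\pi(\mathcal{U})=\sum_x\pi(x)\mathcal{U}(x)$. For $P$ with invariant pmf $\pi$, the Donsker–Varadhan rate function is $$K(P\|P_0)=\sum_{x,x'}\pi(x)P(x,x')\log\Bigl(\frac{P(x,x')}{P_0(x,x')}\Bigr)$$ (with $0\log 0=0$, value $+\infty$ if $\pi(x)P(x,x')>0=P_0(x,x')$ for some $x,x'$). The one-step reward is $$w_\zeta(x,R)=\zeta\,\mathcal{U}(x)-\sum_{x_u'}R(x,x_u')\log\Bigl(\frac{R(x,x_u')}{R_0(x,x_u')}\Bigr),$$ with the same conventions, and in the optimality equation $P$ is obtained from $R$ via $P(x,x')=R(x,x_u')Q_0(x,x_n')$. The pmf $\check\pi_\zeta$ is invariant for $\check P_\zeta$. *)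

theory Defs
  imports "HOL-Analysis.Analysis"
begin

definition is_pmf :: "('a::finite \<Rightarrow> real) \<Rightarrow> bool" where
  "is_pmf p \<longleftrightarrow> (\<forall>x. 0 \<le> p x) \<and> (\<Sum>x\<in>UNIV. p x) = 1"

definition stochastic :: "('a \<Rightarrow> 'b::finite \<Rightarrow> real) \<Rightarrow> bool" where
  "stochastic R \<longleftrightarrow> (\<forall>x. is_pmf (R x))"

primrec nstep :: "('a::finite \<Rightarrow> 'a \<Rightarrow> real) \<Rightarrow> nat \<Rightarrow> 'a \<Rightarrow> 'a \<Rightarrow> real" where
  "nstep P 0 x y = (if x = y then 1 else 0)"
| "nstep P (Suc n) x y = (\<Sum>z\<in>UNIV. P x z * nstep P n z y)"

definition irreducible_chain :: "('a::finite \<Rightarrow> 'a \<Rightarrow> real) \<Rightarrow> bool" where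
  "irreducible_chain P \<longleftrightarrow> (\<forall>x y. \<exists>n\<ge>1. nstep P n x y > 0)"

definition aperiodic_chain :: "('a::finite \<Rightarrow> 'a \<Rightarrow> real) \<Rightarrow> bool" where
  "aperiodic_chain P \<longleftrightarrow> (\<forall>x. Gcd {n. n \<ge> 1 \<and> nstep P n x x > 0} = 1)"

definition invariant_pmf :: "('a::finite \<Rightarrow> 'a \<Rightarrow> real) \<Rightarrow> ('a \<Rightarrow> real) \<Rightarrow> bool" where
  "invariant_pmf P \<pi> \<longleftrightarrow> is_pmf \<pi> \<and> (\<forall>y. (\<Sum>x\<in>UNIV. \<pi> x * P x y) = \<pi> y)"

definition transition ::
    "('u \<times> 'n \<Rightarrow> 'n \<Rightarrow> real) \<Rightarrow> ('u \<times> 'n \<Rightarrow> 'u \<Rightarrow> real) \<Rightarrow> 'u \<times> 'n \<Rightarrow> 'u \<times> 'n \<Rightarrow> real" where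
  "transition Q0 R x x' = R x (fst x') * Q0 x (snd x')"

definition admissible ::
    "('u::finite \<times> 'n \<Rightarrow> 'n \<Rightarrow> real) \<Rightarrow> ('u \<times> 'n \<Rightarrow> 'u \<times> 'n \<Rightarrow> real) \<Rightarrow> bool" where
  "admissible Q0 P \<longleftrightarrow> (\<exists>R. stochastic R \<and> P = transition Q0 R)"

text \<open>The summand \<open>m log (p / q)\<close> with the usual conventions: it is \<open>0\<close> when the weight
  \<open>m\<close> vanishes and \<open>\<infinity>\<close> when \<open>m > 0 = q\<close>. It is only used with weights for which
  \<open>m > 0\<close> implies \<open>p > 0\<close>, and its value is never \<open>-\<infinity>\<close>, so that finite sums of
  such terms are \<open>\<infinity>\<close> exactly when one of the terms is.\<close>

definition log_ratio :: "real \<Rightarrow> real \<Rightarrow> real \<Rightarrow> ereal" where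
  "log_ratio m p q = (if m = 0 then 0 else if q = 0 then \<infinity> else ereal (m * ln (p / q)))"

definition DV_rate ::
    "('a::finite \<Rightarrow> real) \<Rightarrow> ('a \<Rightarrow> 'a \<Rightarrow> real) \<Rightarrow> ('a \<Rightarrow> 'a \<Rightarrow> real) \<Rightarrow> ereal" where
  "DV_rate \<pi> P P0 = (\<Sum>x\<in>UNIV. \<Sum>x'\<in>UNIV. log_ratio (\<pi> x * P x x') (P x x') (P0 x x'))"

definition reward ::
    "('x \<Rightarrow> real) \<Rightarrow> ('x \<Rightarrow> 'u::finite \<Rightarrow> real) \<Rightarrow> real \<Rightarrow> 'x \<Rightarrow> ('x \<Rightarrow> 'u \<Rightarrow> real) \<Rightarrow> ereal" where
  "reward U R0 \<zeta> x R =
     ereal (\<zeta> * U x) - (\<Sum>u\<in>UNIV. log_ratio (R x u) (R x u) (R0 x u))"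

definition DV_objective ::
    "('a::finite \<Rightarrow> real) \<Rightarrow> ('a \<Rightarrow> 'a \<Rightarrow> real) \<Rightarrow> real \<Rightarrow> ('a \<Rightarrow> real) \<times> ('a \<Rightarrow> 'a \<Rightarrow> real) \<Rightarrow> ereal" where
  "DV_objective U P0 \<zeta> = (\<lambda>(\<pi>, P). ereal (\<zeta> * (\<Sum>x\<in>UNIV. \<pi> x * U x)) - DV_rate \<pi> P P0)"

definition attained_max :: "('b \<Rightarrow> ereal) \<Rightarrow> ('b \<Rightarrow> bool) \<Rightarrow> ereal \<Rightarrow> bool" where
  "attained_max f A m \<longleftrightarrow> (\<exists>a. A a \<and> f a = m) \<and> (\<forall>a. A a \<longrightarrow> f a \<le> m)"

definition AROE ::
    "('u::finite \<times> 'n::finite \<Rightarrow> 'n \<Rightarrow> real) \<Rightarrow> ('u \<times> 'n \<Rightarrow> 'u \<Rightarrow> real) \<Rightarrow> ('u \<times> 'n \<Rightarrow> real)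
      \<Rightarrow> real \<Rightarrow> ('u \<times> 'n \<Rightarrow> real) \<Rightarrow> real \<Rightarrow> bool" where
  "AROE Q0 R0 U \<zeta> h \<eta> \<longleftrightarrow>
     (\<forall>x. attained_max
        (\<lambda>R. reward U R0 \<zeta> x R + ereal (\<Sum>x'\<in>UNIV. transition Q0 R x x' * h x'))
        stochastic
        (ereal (h x + \<eta>)))"

definition cond_h ::
    "('u \<times> 'n::finite \<Rightarrow> 'n \<Rightarrow> real) \<Rightarrow> ('u \<times> 'n \<Rightarrow> real) \<Rightarrow> 'u \<times> 'n \<Rightarrow> 'u \<Rightarrow> real" where
  "cond_h Q0 h x u = (\<Sum>n\<in>UNIV. Q0 x n * h (u, n))"

definition Lambda ::
    "('u::finite \<times> 'n::finite \<Rightarrow> 'n \<Rightarrow> real) \<Rightarrow> ('u \<times> 'n \<Rightarrow> 'u \<times> 'n \<Rightarrow> real)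
      \<Rightarrow> ('u \<times> 'n \<Rightarrow> real) \<Rightarrow> 'u \<times> 'n \<Rightarrow> real" where
  "Lambda Q0 P0 h x = ln (\<Sum>x'\<in>UNIV. P0 x x' * exp (cond_h Q0 h x (fst x')))"

end

theory Submission
  imports Defs
begin

text \<open>
  By the Gibbs inequality the maximum in the optimality equation is attained at the exponentially
  tilted kernel, so that the equation becomes \<open>\<zeta> U + T h = h + \<eta>\<close> with the convex operator
  \<open>T = \<Lambda>\<close>, whose derivative at \<open>h\<close> is the tilted transition matrix \<open>P\<^sub>h\<close>. Since \<open>T\<close> commutes with
  adding constants, \<open>h\<close> may be normalised by \<open>h(x\<^sub>0) = \<eta>\<close> instead of \<open>h(x\<^sub>0) = 0\<close>; the equation is then
  \<open>F v = - \<zeta> U\<close> for the map \<open>F v = T v - v - v(x\<^sub>0)\<close> of \<open>\<real>\<^sup>X\<close> to itself. Convexity and the minimum principle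
  for irreducible chains show that \<open>F\<close> is injective with invertible derivative, and that preimages of
  bounded sets are bounded. Hence the range of \<open>F\<close> is open (invariance of domain) and closed, \<open>F\<close> is
  a bijection, and its inverse is differentiable. Cramer's rule gives the continuity of the derivative
  of \<open>\<zeta> \<mapsto> F\<^sup>-\<^sup>1(- \<zeta> U)\<close> and the smoothness of the invariant pmf. Integrating the optimality
  equation against an invariant pmf of a competitor shows that the tilted pair is optimal.
\<close>

section \<open>Probability vectors, the Gibbs inequality and sums of log ratios\<close>

lemma is_pmf_nonneg: "is_pmf p \<Longrightarrow> 0 \<le> p x"
  by (simp add: is_pmf_def)

lemma is_pmf_sum: "is_pmf p \<Longrightarrow> sum p UNIV = 1"
  by (simp add: is_pmf_def)

lemma stochastic_is_pmf: "stochastic R \<Longrightarrow> is_pmf (R x)"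
  unfolding stochastic_def by blast

lemma stochastic_nonneg: "stochastic R \<Longrightarrow> 0 \<le> R x y"
  unfolding stochastic_def by (blast intro: is_pmf_nonneg)

lemma stochastic_sum: "stochastic R \<Longrightarrow> sum (R x) UNIV = 1"
  unfolding stochastic_def by (blast intro: is_pmf_sum)

lemma stochasticI: "(\<And>x y. 0 \<le> R x y) \<Longrightarrow> (\<And>x. sum (R x) UNIV = 1) \<Longrightarrow> stochastic R"
  by (simp add: stochastic_def is_pmf_def)

text \<open>Concavity of the logarithm, used as \<open>ln t \<le> t - 1\<close> with
  \<open>t\<close> the ratio of the normalised density \<open>q x * exp (f x) / Z\<close> to
  \<open>p x\<close>, then averaged over \<open>p\<close>. Since \<open>q\<close> is nonzero
  wherever \<open>p\<close> is, both the logarithms and \<open>Z > 0\<close> are under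
  control.\<close>

lemma gibbs_inequality:
  fixes p q f :: "'a::finite \<Rightarrow> real"
  assumes p: "is_pmf p" and q: "\<And>x. 0 \<le> q x" and pq: "\<And>x. p x \<noteq> 0 \<Longrightarrow> q x \<noteq> 0"
  shows "(\<Sum>x\<in>UNIV. p x * f x) - (\<Sum>x\<in>UNIV. p x * ln (p x / q x)) \<le> ln (\<Sum>x\<in>UNIV. q x * exp (f x))"
proof -
  define Z where "Z = (\<Sum>x\<in>UNIV. q x * exp (f x))"
  have "\<exists>a. p a \<noteq> 0"
    using is_pmf_sum[OF p] by (metis sum.neutral zero_neq_one)
  then obtain a where "p a \<noteq> 0" ..
  then have "0 < q a"
    using pq[of a] q[of a] by simp
  then have Z: "0 < Z"
    unfolding Z_def by (intro sum_pos2[of _ a]) (auto simp: q)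
  have le: "p x * (f x - ln (p x / q x) - ln Z) \<le> q x * exp (f x) / Z - p x" for x
  proof (cases "p x = 0")
    case True
    then show ?thesis using q[of x] Z by simp
  next
    case False
    then have px: "0 < p x" and qx: "0 < q x"
      using is_pmf_nonneg[OF p, of x] pq[of x] q[of x] by auto
    have "f x - ln (p x / q x) - ln Z = ln (q x * exp (f x) / (Z * p x))"
      using px qx Z by (simp add: ln_div ln_mult)
    also have "\<dots> \<le> q x * exp (f x) / (Z * p x) - 1"
      using px qx Z by (intro ln_le_minus_one) simp
    finally have "p x * (f x - ln (p x / q x) - ln Z) \<le> p x * (q x * exp (f x) / (Z * p x) - 1)"
      using px by (intro mult_left_mono) auto
    also have "\<dots> = q x * exp (f x) / Z - p x"
      using px by (simp add: field_simps)
    finally show ?thesis .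
  qed
  have "(\<Sum>x\<in>UNIV. p x * (f x - ln (p x / q x) - ln Z)) \<le> (\<Sum>x\<in>UNIV. q x * exp (f x) / Z - p x)"
    by (intro sum_mono le)
  also have "\<dots> = 0"
    using Z is_pmf_sum[OF p] by (simp add: sum_subtractf Z_def flip: sum_divide_distrib)
  finally show ?thesis
    using is_pmf_sum[OF p]
    by (simp add: right_diff_distrib sum_subtractf Z_def flip: sum_distrib_right)
qed

lemma sum_log_ratio_finite:
  assumes "\<And>x. x \<in> A \<Longrightarrow> m x \<noteq> 0 \<Longrightarrow> q x \<noteq> 0"
  shows "(\<Sum>x\<in>A. log_ratio (m x) (p x) (q x)) = ereal (\<Sum>x\<in>A. m x * ln (p x / q x))"
proof -
  have "(\<Sum>x\<in>A. log_ratio (m x) (p x) (q x)) = (\<Sum>x\<in>A. ereal (m x * ln (p x / q x)))"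
    using assms by (intro sum.cong) (auto simp: log_ratio_def)
  then show ?thesis by simp
qed

lemma sum_log_ratio_infinite:
  fixes m :: "'a::finite \<Rightarrow> real"
  assumes "m a \<noteq> 0" "q a = 0"
  shows "(\<Sum>x\<in>UNIV. log_ratio (m x) (p x) (q x)) = \<infinity>"
  unfolding sum_Pinfty using assms by (auto simp: log_ratio_def intro!: exI[of _ a])

section \<open>The minimum principle for irreducible chains\<close>

lemma finite_argmin:
  fixes d :: "'a::finite \<Rightarrow> real"
  shows "\<exists>a. \<forall>x. d a \<le> d x"
  using Min_in[of "range d"] Min_le[of "range d"] by fastforce

lemma finite_argmax:
  fixes d :: "'a::finite \<Rightarrow> real"
  shows "\<exists>a. \<forall>x. d x \<le> d a"
  using Max_in[of "range d"] Max_ge[of "range d"] by fastforce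

lemma nstep_nonneg:
  assumes "\<And>x y. 0 \<le> P x y"
  shows "0 \<le> nstep P n x y"
  using assms by (induction n arbitrary: x) (auto intro!: sum_nonneg)

text \<open>At a minimiser of \<open>d\<close> the \<open>Q\<close>-mean of the nonnegative function
  \<open>d - min d\<close> is at most zero, so every \<open>Q\<close>-successor is again a
  minimiser, and paths of \<open>P\<close> spread this to all states. Two kernels appear because
  irreducibility is known for the nominal chain, while superharmonicity will hold for a tilted chain
  with at least the same support.\<close>

lemma irreducible_superharmonic_const:
  fixes P Q :: "'a::finite \<Rightarrow> 'a \<Rightarrow> real"
  assumes irr: "irreducible_chain P" and P: "\<And>x y. 0 \<le> P x y"
    and Q: "stochastic Q" and PQ: "\<And>x y. P x y \<noteq> 0 \<Longrightarrow> Q x y \<noteq> 0"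
    and super: "\<And>x. (\<Sum>y\<in>UNIV. Q x y * d y) \<le> d x"
  shows "d x = d y"
proof -
  obtain a where a: "\<And>x. d a \<le> d x"
    using finite_argmin[of d] by blast
  have step: "d z = d a" if "d x = d a" "P x z \<noteq> 0" for x z
  proof -
    have nn: "0 \<le> Q x y * (d y - d a)" for y
      using Q a[of y] by (auto simp: stochastic_def is_pmf_def)
    have "(\<Sum>y\<in>UNIV. Q x y * (d y - d a)) = (\<Sum>y\<in>UNIV. Q x y * d y) - d a"
      using Q by (simp add: right_diff_distrib sum_subtractf stochastic_def is_pmf_def
          flip: sum_distrib_right)
    then have "(\<Sum>y\<in>UNIV. Q x y * (d y - d a)) \<le> 0"
      using super[of x] that by simp
    then have "(\<Sum>y\<in>UNIV. Q x y * (d y - d a)) = 0"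
      by (meson nn sum_nonneg antisym)
    then have "Q x z * (d z - d a) = 0"
      using nn by (simp add: sum_nonneg_eq_0_iff)
    then show ?thesis using PQ[OF that(2)] by simp
  qed
  have "d y = d a" if "d x = d a" "0 < nstep P n x y" for n x y
    using that
  proof (induction n arbitrary: x)
    case 0
    then show ?case by (auto split: if_splits)
  next
    case (Suc n)
    then have "(\<Sum>z\<in>UNIV. P x z * nstep P n z y) \<noteq> 0"
      by simp
    then obtain z where "P x z * nstep P n z y \<noteq> 0"
      by (rule sum.not_neutral_contains_not_neutral)
    then show ?case
      using Suc.prems step[of x z] nstep_nonneg[where P = P and n = n and x = z and y = y] P
      by (intro Suc.IH[of z]) (auto simp: less_le)
  qed
  then have "d y = d a" for y
    using irr unfolding irreducible_chain_def by blast
  then show ?thesis by metis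
qed

section \<open>Calculus of C1 functions of one real variable, up to determinants\<close>

lemma C1_differentiable_on_sum:
  "(\<And>i. i \<in> A \<Longrightarrow> (\<lambda>t. f i t) C1_differentiable_on S) \<Longrightarrow> (\<lambda>t. \<Sum>i\<in>A. f i t) C1_differentiable_on S"
  by (induction A rule: infinite_finite_induct) auto

lemma C1_differentiable_on_prod:
  fixes f :: "'i \<Rightarrow> real \<Rightarrow> real"
  shows "(\<And>i. i \<in> A \<Longrightarrow> (\<lambda>t. f i t) C1_differentiable_on S) \<Longrightarrow> (\<lambda>t. \<Prod>i\<in>A. f i t) C1_differentiable_on S"
  by (induction A rule: infinite_finite_induct) auto

lemma C1_differentiable_on_exp:
  fixes f :: "real \<Rightarrow> real"
  assumes "f C1_differentiable_on S"
  shows "(\<lambda>t. exp (f t)) C1_differentiable_on S"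
proof -
  obtain D where D: "\<And>t. t \<in> S \<Longrightarrow> (f has_real_derivative D t) (at t)" "continuous_on S D"
    using assms by (auto simp: C1_differentiable_on_def has_real_derivative_iff_has_vector_derivative)
  then have f: "continuous_on S f"
    by (meson DERIV_isCont continuous_at_imp_continuous_on)
  show ?thesis
    unfolding C1_differentiable_on_def has_real_derivative_iff_has_vector_derivative[symmetric]
    using D f by (intro exI[of _ "\<lambda>t. exp (f t) * D t"])
      (auto intro!: derivative_eq_intros continuous_intros)
qed

lemma C1_differentiable_on_divide:
  fixes f g :: "real \<Rightarrow> real"
  assumes "f C1_differentiable_on S" "g C1_differentiable_on S" "\<And>t. t \<in> S \<Longrightarrow> g t \<noteq> 0"
  shows "(\<lambda>t. f t / g t) C1_differentiable_on S"
proof -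
  obtain D where D: "\<And>t. t \<in> S \<Longrightarrow> (f has_real_derivative D t) (at t)" "continuous_on S D"
    using assms by (auto simp: C1_differentiable_on_def has_real_derivative_iff_has_vector_derivative)
  obtain E where E: "\<And>t. t \<in> S \<Longrightarrow> (g has_real_derivative E t) (at t)" "continuous_on S E"
    using assms by (auto simp: C1_differentiable_on_def has_real_derivative_iff_has_vector_derivative)
  have f: "continuous_on S f" "continuous_on S g"
    using D E by (meson DERIV_isCont continuous_at_imp_continuous_on)+
  show ?thesis
    unfolding C1_differentiable_on_def has_real_derivative_iff_has_vector_derivative[symmetric]
    using D E f assms(3)
    by (intro exI[of _ "\<lambda>t. (D t * g t - f t * E t) / (g t * g t)"])
      (auto intro!: derivative_eq_intros continuous_intros)
qed

lemma C1_differentiable_on_det: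
  fixes M :: "real \<Rightarrow> real ^'n ^'n"
  assumes "\<And>i j. (\<lambda>t. M t $ i $ j) C1_differentiable_on S"
  shows "(\<lambda>t. det (M t)) C1_differentiable_on S"
  unfolding det_def
  by (intro C1_differentiable_on_sum C1_differentiable_on_mult C1_differentiable_on_prod
      C1_differentiable_on_const assms)

lemma continuous_on_det:
  fixes M :: "'a::topological_space \<Rightarrow> real ^'n ^'n"
  assumes "\<And>i j. continuous_on S (\<lambda>t. M t $ i $ j)"
  shows "continuous_on S (\<lambda>t. det (M t))"
  unfolding det_def by (intro continuous_intros assms)

section \<open>Averages under stochastic kernels, and invariant vectors\<close>

lemma stochastic_mean_ge:
  assumes "stochastic Q" "\<And>y. m \<le> d y"
  shows "m \<le> (\<Sum>y\<in>UNIV. Q x y * d y)"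
proof -
  have "(\<Sum>y\<in>UNIV. Q x y * m) \<le> (\<Sum>y\<in>UNIV. Q x y * d y)"
    using assms by (intro sum_mono mult_left_mono stochastic_nonneg)
  then show ?thesis
    by (simp add: stochastic_sum[OF assms(1)] flip: sum_distrib_right)
qed

lemma stochastic_mean_le:
  assumes "stochastic Q" "\<And>y. d y \<le> m"
  shows "(\<Sum>y\<in>UNIV. Q x y * d y) \<le> m"
  using stochastic_mean_ge[of Q "-m" "\<lambda>y. - d y" x] assms by (simp add: sum_negf)

text \<open>Each step of the chain raises the mean of \<open>g\<close> by at most \<open>c\<close>.
  With \<open>g\<close> nonnegative this bounds \<open>g\<close> at any state that is reachable from
  \<open>x\<close>.\<close>

lemma nstep_mean_le:
  assumes P: "stochastic P" and g: "\<And>x. (\<Sum>y\<in>UNIV. P x y * g y) \<le> g x + c"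
  shows "(\<Sum>y\<in>UNIV. nstep P n x y * g y) \<le> g x + real n * c"
proof (induction n arbitrary: x)
  case 0
  have "(\<Sum>y\<in>UNIV. nstep P 0 x y * g y) = (\<Sum>y\<in>UNIV. if x = y then g y else 0)"
    by (intro sum.cong) auto
  then show ?case by simp
next
  case (Suc n)
  have "(\<Sum>y\<in>UNIV. nstep P (Suc n) x y * g y) = (\<Sum>z\<in>UNIV. P x z * (\<Sum>y\<in>UNIV. nstep P n z y * g y))"
    by (simp add: sum_distrib_left sum_distrib_right mult.assoc) (rule sum.swap)
  also have "\<dots> \<le> (\<Sum>z\<in>UNIV. P x z * (g z + real n * c))"
    by (intro sum_mono mult_left_mono Suc.IH stochastic_nonneg P)
  also have "\<dots> = (\<Sum>z\<in>UNIV. P x z * g z) + real n * c"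
    by (simp add: distrib_left sum.distrib stochastic_sum[OF P] flip: sum_distrib_right)
  also have "\<dots> \<le> g x + real (Suc n) * c"
    using g[of x] by (simp add: distrib_right)
  finally show ?case .
qed

lemma has_derivative_vec_nth: "((\<lambda>v. v $ i) has_derivative (\<lambda>k. k $ i)) F"
  by (rule bounded_linear_imp_has_derivative) (rule bounded_linear_vec_nth)

lemma has_derivative_vecI:
  fixes f :: "'a::real_normed_vector \<Rightarrow> real ^'n"
  assumes "\<And>i. ((\<lambda>v. f v $ i) has_derivative (\<lambda>k. f' k $ i)) (at x)"
  shows "(f has_derivative f') (at x)"
  using assms by (subst has_derivative_componentwise_within) (auto simp: Basis_vec_def inner_axis)

lemma invariant_pmf_mean:
  assumes "invariant_pmf P \<pi>"
  shows "(\<Sum>x\<in>UNIV. \<pi> x * (\<Sum>y\<in>UNIV. P x y * g y)) = (\<Sum>y\<in>UNIV. \<pi> y * g y)"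
proof -
  have "(\<Sum>x\<in>UNIV. \<pi> x * (\<Sum>y\<in>UNIV. P x y * g y)) = (\<Sum>x\<in>UNIV. \<Sum>y\<in>UNIV. \<pi> x * P x y * g y)"
    by (simp add: sum_distrib_left mult.assoc)
  also have "\<dots> = (\<Sum>y\<in>UNIV. (\<Sum>x\<in>UNIV. \<pi> x * P x y) * g y)"
    by (subst sum.swap) (simp add: sum_distrib_right)
  finally show ?thesis
    using assms by (simp add: invariant_pmf_def)
qed

text \<open>The triangle inequality makes \<open>\<bar>m\<bar>\<close> pointwise at most its image
  under \<open>P\<close>. Both have the same total mass since \<open>P\<close> is stochastic, so no
  inequality can be strict.\<close>

lemma signed_invariant_abs:
  fixes P :: "'a::finite \<Rightarrow> 'a \<Rightarrow> real"
  assumes P: "stochastic P" and inv: "\<And>y. (\<Sum>x\<in>UNIV. m x * P x y) = m y"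
  shows "(\<Sum>x\<in>UNIV. \<bar>m x\<bar> * P x y) = \<bar>m y\<bar>"
proof -
  have le: "0 \<le> (\<Sum>x\<in>UNIV. \<bar>m x\<bar> * P x y) - \<bar>m y\<bar>" for y
    using sum_abs[of "\<lambda>x. m x * P x y" UNIV] inv[of y] stochastic_nonneg[OF P]
    by (simp add: abs_mult)
  have "(\<Sum>y\<in>UNIV. \<Sum>x\<in>UNIV. \<bar>m x\<bar> * P x y) = (\<Sum>x\<in>UNIV. \<bar>m x\<bar>)"
    by (subst sum.swap) (simp add: stochastic_sum[OF P] flip: sum_distrib_left)
  then have "(\<Sum>y\<in>UNIV. (\<Sum>x\<in>UNIV. \<bar>m x\<bar> * P x y) - \<bar>m y\<bar>) = 0"
    by (simp add: sum_subtractf)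
  then show ?thesis
    using le by (simp add: sum_nonneg_eq_0_iff)
qed

lemma sum_transition:
  fixes Q0 :: "'u::finite \<times> 'n::finite \<Rightarrow> 'n \<Rightarrow> real"
  shows "(\<Sum>x'\<in>UNIV. transition Q0 R x x' * g x')
    = (\<Sum>u\<in>UNIV. R x u * (\<Sum>n\<in>UNIV. Q0 x n * g (u, n)))"
  by (simp add: transition_def sum_distrib_left mult.assoc sum.cartesian_product
      case_prod_unfold flip: UNIV_Times_UNIV)

section \<open>Transition matrices of the product form\<close>

locale controlled_chain=
  fixes Q0 :: "'u::finite \<times> 'n::finite \<Rightarrow> 'n \<Rightarrow> real"
    and R0 :: "'u \<times> 'n \<Rightarrow> 'u \<Rightarrow> real"
    and P0 :: "'u \<times> 'n \<Rightarrow> 'u \<times> 'n \<Rightarrow> real"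
  assumes Q0: "stochastic Q0" and R0: "stochastic R0"
    and P0_eq: "P0 = transition Q0 R0"
    and irreducible: "irreducible_chain P0"
begin

lemma Q0_nonneg: "0 \<le> Q0 x n" and Q0_sum: "(\<Sum>n\<in>UNIV. Q0 x n) = 1"
  using stochastic_nonneg[OF Q0] stochastic_sum[OF Q0] by auto

lemma R0_nonneg: "0 \<le> R0 x u" and R0_sum: "(\<Sum>u\<in>UNIV. R0 x u) = 1"
  using stochastic_nonneg[OF R0] stochastic_sum[OF R0] by auto

lemma sum_transition_fst:
  "(\<Sum>x'\<in>UNIV. transition Q0 R x x' * g (fst x')) = (\<Sum>u\<in>UNIV. R x u * g u)"
  by (simp add: sum_transition Q0_sum flip: sum_distrib_right)

text \<open>Given \<open>x\<close>, the two components of the next state are independent and the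
  second has law \<open>Q0 x\<close>, so averaging it out first does not change the mean. This is
  why a tilt depending on the first component alone suffices.\<close>

lemma sum_transition_cond_h:
  "(\<Sum>x'\<in>UNIV. transition Q0 R x x' * cond_h Q0 g x (fst x'))
    = (\<Sum>x'\<in>UNIV. transition Q0 R x x' * g x')"
  unfolding sum_transition_fst[where g = "cond_h Q0 g x"]
  by (simp add: sum_transition cond_h_def)

lemma stochastic_transition:
  assumes "stochastic R"
  shows "stochastic (transition Q0 R)"
proof -
  have "(\<Sum>x'\<in>UNIV. transition Q0 R x x') = 1" for x
    using sum_transition_fst[of R x "\<lambda>_. 1"] stochastic_sum[OF assms, of x] by simp
  then show ?thesis
    by (intro stochasticI) (auto simp: transition_def stochastic_nonneg[OF assms] Q0_nonneg)
qed

lemma P0_stochastic: "stochastic P0"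
  unfolding P0_eq by (rule stochastic_transition[OF R0])

lemma P0_nonneg: "0 \<le> P0 x y"
  using P0_stochastic by (rule stochastic_nonneg)

section \<open>Exponential tilting and the convexity of \<open>T\<close>\<close>

abbreviation T :: "('u \<times> 'n \<Rightarrow> real) \<Rightarrow> 'u \<times> 'n \<Rightarrow> real" where
  "T \<equiv> Lambda Q0 P0"

text \<open>The Gibbs measure that gives equality in \<open>gibbs_inequality\<close>. Only the
  control is tilted, because nature's kernel \<open>Q0\<close> is fixed.\<close>

definition tilt :: "('u \<times> 'n \<Rightarrow> real) \<Rightarrow> 'u \<times> 'n \<Rightarrow> 'u \<Rightarrow> real" where
  "tilt h x u = R0 x u * exp (cond_h Q0 h x u - T h x)"

abbreviation tiltP :: "('u \<times> 'n \<Rightarrow> real) \<Rightarrow> 'u \<times> 'n \<Rightarrow> 'u \<times> 'n \<Rightarrow> real" where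
  "tiltP h \<equiv> transition Q0 (tilt h)"

lemma tiltP_eq: "tiltP h x x' = P0 x x' * exp (cond_h Q0 h x (fst x') - T h x)"
proof -
  have "P0 x x' = R0 x (fst x') * Q0 x (snd x')"
    by (simp add: P0_eq transition_def)
  then show ?thesis
    by (simp add: transition_def tilt_def)
qed

lemma partition_pos: "0 < (\<Sum>x'\<in>UNIV. P0 x x' * exp (cond_h Q0 h x (fst x')))"
proof -
  have "(\<Sum>y\<in>UNIV. P0 x y) \<noteq> 0"
    by (simp add: stochastic_sum[OF P0_stochastic])
  then obtain y where "P0 x y \<noteq> 0"
    by (rule sum.not_neutral_contains_not_neutral)
  then have "0 < P0 x y"
    using P0_nonneg[of x y] by simp
  then show ?thesis
    by (intro sum_pos2[of _ y]) (auto simp: P0_nonneg)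
qed

lemma T_eq: "T h x = ln (\<Sum>u\<in>UNIV. R0 x u * exp (cond_h Q0 h x u))"
  unfolding Lambda_def P0_eq sum_transition_fst[where g = "\<lambda>u. exp (cond_h Q0 h x u)"] ..

lemma tilt_stochastic: "stochastic (tilt h)"
proof -
  have pos: "0 < (\<Sum>u\<in>UNIV. R0 x u * exp (cond_h Q0 h x u))" for x
    using partition_pos[of x h]
    unfolding P0_eq sum_transition_fst[where g = "\<lambda>u. exp (cond_h Q0 h x u)"] .
  have "(\<Sum>u\<in>UNIV. tilt h x u) = 1" for x
    using pos[of x] by (simp add: tilt_def exp_diff T_eq flip: sum_divide_distrib)
  then show ?thesis
    by (intro stochasticI) (auto simp: tilt_def R0_nonneg)
qed

lemma tiltP_stochastic: "stochastic (tiltP h)"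
  by (rule stochastic_transition[OF tilt_stochastic])

lemma T_zero: "T (\<lambda>_. 0) x = 0"
  by (simp add: Lambda_def cond_h_def stochastic_sum[OF P0_stochastic])

lemma tiltP_zero: "tiltP (\<lambda>_. 0) = P0"
  by (intro ext) (simp add: tiltP_eq T_zero cond_h_def)

lemma P0_nonzero_imp_tiltP: "P0 x y \<noteq> 0 \<Longrightarrow> tiltP h x y \<noteq> 0"
  by (simp add: tiltP_eq)

lemma tiltP_nonzero_imp_P0: "tiltP h x y \<noteq> 0 \<Longrightarrow> P0 x y \<noteq> 0"
  by (auto simp: tiltP_eq)

lemma tiltP_sum: "(\<Sum>y\<in>UNIV. tiltP h x y) = 1"
  by (rule stochastic_sum[OF tiltP_stochastic])

text \<open>The log-likelihood ratio of the tilted control is its exponent, so the bound of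
  \<open>gibbs_control\<close> is attained.\<close>

lemma sum_tilt_ln: "(\<Sum>u\<in>UNIV. tilt h x u * ln (tilt h x u / R0 x u))
    = (\<Sum>x'\<in>UNIV. tiltP h x x' * h x') - T h x"
proof -
  have "(\<Sum>u\<in>UNIV. tilt h x u * ln (tilt h x u / R0 x u))
      = (\<Sum>u\<in>UNIV. tilt h x u * (cond_h Q0 h x u - T h x))"
    by (intro sum.cong) (auto simp: tilt_def)
  also have "\<dots> = (\<Sum>u\<in>UNIV. tilt h x u * cond_h Q0 h x u) - T h x"
    by (simp add: right_diff_distrib sum_subtractf stochastic_sum[OF tilt_stochastic]
        flip: sum_distrib_right)
  also have "(\<Sum>u\<in>UNIV. tilt h x u * cond_h Q0 h x u) = (\<Sum>x'\<in>UNIV. tiltP h x x' * h x')"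
    by (simp add: sum_transition cond_h_def)
  finally show ?thesis .
qed

lemma gibbs_control:
  assumes "stochastic R" "\<And>u. R x u \<noteq> 0 \<Longrightarrow> R0 x u \<noteq> 0"
  shows "(\<Sum>x'\<in>UNIV. transition Q0 R x x' * h x')
    - (\<Sum>u\<in>UNIV. R x u * ln (R x u / R0 x u)) \<le> T h x"
  using gibbs_inequality[where f = "cond_h Q0 h x", OF stochastic_is_pmf[OF assms(1)] R0_nonneg assms(2)]
  by (simp add: T_eq sum_transition cond_h_def)

text \<open>The counterpart of \<open>gibbs_control\<close> for whole rows, as they occur in
  \<open>DV_rate\<close>. The Gibbs inequality is applied to \<open>cond_h\<close>, and
  admissibility of \<open>P\<close> turns its mean back into that of \<open>h\<close>.\<close>

lemma gibbs_transition:
  assumes "admissible Q0 P" "\<And>x'. P x x' \<noteq> 0 \<Longrightarrow> P0 x x' \<noteq> 0"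
  shows "(\<Sum>x'\<in>UNIV. P x x' * h x') - (\<Sum>x'\<in>UNIV. P x x' * ln (P x x' / P0 x x')) \<le> T h x"
proof -
  obtain R where R: "stochastic R" "P = transition Q0 R"
    using assms by (auto simp: admissible_def)
  then have "is_pmf (P x)"
    by (simp add: stochastic_is_pmf stochastic_transition)
  then show ?thesis
    using gibbs_inequality[where p = "P x" and q = "P0 x" and f = "\<lambda>x'. cond_h Q0 h x (fst x')",
        OF _ P0_nonneg assms(2)]
    by (simp add: Lambda_def R sum_transition_cond_h)
qed

lemma sum_tiltP_ln: "(\<Sum>x'\<in>UNIV. tiltP h x x' * ln (tiltP h x x' / P0 x x'))
    = (\<Sum>x'\<in>UNIV. tiltP h x x' * h x') - T h x"
proof -
  have "(\<Sum>x'\<in>UNIV. tiltP h x x' * ln (tiltP h x x' / P0 x x'))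
      = (\<Sum>x'\<in>UNIV. tiltP h x x' * (cond_h Q0 h x (fst x') - T h x))"
    by (intro sum.cong) (auto simp: tiltP_eq)
  then show ?thesis
    by (simp add: right_diff_distrib sum_subtractf sum_transition_cond_h tiltP_sum
        flip: sum_distrib_right)
qed

text \<open>By the Gibbs inequality \<open>T g x\<close> dominates mean minus entropy for every
  admissible kernel. Inserting the kernel that is optimal for \<open>h\<close> gives the tangent
  plane at \<open>h\<close>, whose gradient is the tilted row.\<close>

lemma T_convex: "T h x + (\<Sum>y\<in>UNIV. tiltP h x y * (g y - h y)) \<le> T g x"
proof -
  have "admissible Q0 (tiltP h)"
    unfolding admissible_def using tilt_stochastic by blast
  moreover have "P0 x y \<noteq> 0" if "tiltP h x y \<noteq> 0" for y
    using that by (auto simp: tiltP_eq)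
  ultimately show ?thesis
    using gibbs_transition[of "tiltP h" x g] sum_tiltP_ln[of h x]
    by (simp add: right_diff_distrib sum_subtractf)
qed

section \<open>Verification: the fixed-point equation implies optimality\<close>

lemma AROE_of_fixed_point:
  assumes "\<And>x. \<zeta> * U x + T h x = h x + \<eta>"
  shows "AROE Q0 R0 U \<zeta> h \<eta>"
  unfolding AROE_def attained_max_def
proof (intro allI conjI impI exI)
  fix x
  show "stochastic (tilt h)" by (rule tilt_stochastic)
  have *: "(\<Sum>u\<in>UNIV. log_ratio (tilt h x u) (tilt h x u) (R0 x u))
      = ereal (\<Sum>u\<in>UNIV. tilt h x u * ln (tilt h x u / R0 x u))"
    by (intro sum_log_ratio_finite) (auto simp: tilt_def)
  show "reward U R0 \<zeta> x (tilt h) + ereal (\<Sum>x'\<in>UNIV. tiltP h x x' * h x') = ereal (h x + \<eta>)"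
    using assms[of x] by (simp add: reward_def * sum_tilt_ln)
next
  fix x and R :: "'u \<times> 'n \<Rightarrow> 'u \<Rightarrow> real"
  assume R: "stochastic R"
  show "reward U R0 \<zeta> x R + ereal (\<Sum>x'\<in>UNIV. transition Q0 R x x' * h x') \<le> ereal (h x + \<eta>)"
  proof (cases "\<forall>u. R x u \<noteq> 0 \<longrightarrow> R0 x u \<noteq> 0")
    case True
    then have "(\<Sum>u\<in>UNIV. log_ratio (R x u) (R x u) (R0 x u))
      = ereal (\<Sum>u\<in>UNIV. R x u * ln (R x u / R0 x u))"
      by (intro sum_log_ratio_finite) auto
    then show ?thesis
      using gibbs_control[OF R, of x h] True assms[of x] by (simp add: reward_def)
  next
    \<comment> \<open>A control that charges some \<open>u\<close> with \<open>R0 x u = 0\<close>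
      has reward \<open>-\<infinity>\<close>.\<close>
    case False
    then obtain u where "R x u \<noteq> 0" "R0 x u = 0" by blast
    then show ?thesis
      by (simp add: reward_def sum_log_ratio_infinite)
  qed
qed

lemma DV_rate_finite:
  assumes "\<And>x y. \<pi> x \<noteq> 0 \<Longrightarrow> P x y \<noteq> 0 \<Longrightarrow> P0 x y \<noteq> 0"
  shows "DV_rate \<pi> P P0 = ereal (\<Sum>x\<in>UNIV. \<pi> x * (\<Sum>y\<in>UNIV. P x y * ln (P x y / P0 x y)))"
proof -
  have "(\<Sum>y\<in>UNIV. log_ratio (\<pi> x * P x y) (P x y) (P0 x y))
      = ereal (\<Sum>y\<in>UNIV. \<pi> x * P x y * ln (P x y / P0 x y))" for x
    using assms by (intro sum_log_ratio_finite) auto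
  then show ?thesis
    by (simp add: DV_rate_def sum_distrib_left mult.assoc)
qed

text \<open>Averaging the row-wise Gibbs bound over \<open>\<pi>\<close> cancels \<open>h\<close>
  against its image under \<open>P\<close> by invariance, and only \<open>\<eta>\<close>
  remains.\<close>

lemma DV_objective_le:
  assumes fp: "\<And>x. \<zeta> * U x + T h x = h x + \<eta>"
    and P: "admissible Q0 P" and \<pi>: "invariant_pmf P \<pi>"
  shows "DV_objective U P0 \<zeta> (\<pi>, P) \<le> ereal \<eta>"
proof (cases "\<forall>x y. \<pi> x \<noteq> 0 \<longrightarrow> P x y \<noteq> 0 \<longrightarrow> P0 x y \<noteq> 0")
  case True
  have pmf: "is_pmf \<pi>" using \<pi> by (simp add: invariant_pmf_def)
  \<comment> \<open>The weight comes first because a finite rate controls the support of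
    \<open>P x\<close> only in rows with \<open>\<pi> x \<noteq> 0\<close>.\<close>
  have "\<pi> x * (\<zeta> * U x - (\<Sum>y\<in>UNIV. P x y * ln (P x y / P0 x y)))
      \<le> \<pi> x * (h x + \<eta> - (\<Sum>y\<in>UNIV. P x y * h y))" for x
  proof (cases "\<pi> x = 0")
    case False
    then show ?thesis
      using gibbs_transition[OF P, of x h] True fp[of x] is_pmf_nonneg[OF pmf, of x]
      by (intro mult_left_mono) auto
  qed simp
  then have "(\<Sum>x\<in>UNIV. \<pi> x * (\<zeta> * U x - (\<Sum>y\<in>UNIV. P x y * ln (P x y / P0 x y))))
      \<le> (\<Sum>x\<in>UNIV. \<pi> x * (h x + \<eta> - (\<Sum>y\<in>UNIV. P x y * h y)))"
    by (rule sum_mono)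
  also have "\<dots> = \<eta>"
    using invariant_pmf_mean[OF \<pi>, of h] is_pmf_sum[OF pmf]
    by (simp add: right_diff_distrib distrib_left sum.distrib sum_subtractf flip: sum_distrib_right)
  finally have "\<zeta> * (\<Sum>x\<in>UNIV. \<pi> x * U x)
      - (\<Sum>x\<in>UNIV. \<pi> x * (\<Sum>y\<in>UNIV. P x y * ln (P x y / P0 x y))) \<le> \<eta>"
    by (simp add: right_diff_distrib sum_subtractf sum_distrib_left mult.left_commute)
  then show ?thesis
    using DV_rate_finite[of \<pi> P] True by (simp add: DV_objective_def)
next
  case False
  then obtain x y where xy: "\<pi> x * P x y \<noteq> 0" "P0 x y = 0" by auto
  then have "(\<Sum>y\<in>UNIV. log_ratio (\<pi> x * P x y) (P x y) (P0 x y)) = \<infinity>"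
    by (rule sum_log_ratio_infinite)
  then have "DV_rate \<pi> P P0 = \<infinity>"
    unfolding DV_rate_def sum_Pinfty by blast
  then show ?thesis
    by (simp add: DV_objective_def)
qed

lemma DV_objective_tiltP:
  assumes fp: "\<And>x. \<zeta> * U x + T h x = h x + \<eta>" and \<pi>: "invariant_pmf (tiltP h) \<pi>"
  shows "DV_objective U P0 \<zeta> (\<pi>, tiltP h) = ereal \<eta>"
proof -
  have "\<zeta> * (\<Sum>x\<in>UNIV. \<pi> x * U x) = (\<Sum>x\<in>UNIV. \<pi> x * (\<zeta> * U x))"
    by (simp add: sum_distrib_left mult.left_commute)
  also have "\<dots> = (\<Sum>x\<in>UNIV. \<pi> x * (h x + \<eta> - T h x))"
    by (metis fp add_diff_cancel_right')
  also have "\<dots> = (\<Sum>x\<in>UNIV. \<pi> x * h x) + \<eta> - (\<Sum>x\<in>UNIV. \<pi> x * T h x)"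
    using \<pi> by (simp add: right_diff_distrib distrib_left sum.distrib sum_subtractf
        invariant_pmf_def is_pmf_def flip: sum_distrib_right)
  finally show ?thesis
    using DV_rate_finite[of \<pi> "tiltP h"] invariant_pmf_mean[OF \<pi>, of h]
    by (simp add: DV_objective_def tiltP_nonzero_imp_P0 sum_tiltP_ln right_diff_distrib sum_subtractf)
qed

section \<open>The map \<open>bellman\<close>: invertible Jacobian, injectivity, coercivity\<close>

lemma cond_h_shift: "cond_h Q0 (\<lambda>y. h y - c) x u = cond_h Q0 h x u - c"
  by (simp add: cond_h_def right_diff_distrib sum_subtractf Q0_sum flip: sum_distrib_right)

lemma T_shift: "T (\<lambda>y. h y - c) x = T h x - c"
proof -
  have "T (\<lambda>y. h y - c) x = ln ((\<Sum>x'\<in>UNIV. P0 x x' * exp (cond_h Q0 h x (fst x'))) / exp c)"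
    by (simp add: Lambda_def cond_h_shift exp_diff sum_divide_distrib)
  also have "\<dots> = T h x - c"
    using partition_pos[of x h] by (simp add: ln_div Lambda_def)
  finally show ?thesis .
qed

text \<open>The equation at a minimiser and at a maximiser of \<open>k\<close> gives both signs of
  \<open>c\<close>; then the minimum principle applies.\<close>

lemma harmonic_up_to_const:
  assumes "\<And>x. (\<Sum>y\<in>UNIV. tiltP h x y * k y) = k x + c"
  shows "c = 0" "k x = k y"
proof -
  obtain a where "\<And>x. k a \<le> k x" using finite_argmin[of k] by blast
  then have "0 \<le> c"
    using stochastic_mean_ge[OF tiltP_stochastic, of "k a" k h a] assms[of a] by simp
  obtain b where "\<And>x. k x \<le> k b" using finite_argmax[of k] by blast
  then have "c \<le> 0"
    using stochastic_mean_le[OF tiltP_stochastic, of k "k b" h b] assms[of b] by simp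
  with \<open>0 \<le> c\<close> show "c = 0" by simp
  with assms show "k x = k y"
    by (intro irreducible_superharmonic_const[OF irreducible P0_nonneg
          tiltP_stochastic[of h] P0_nonzero_imp_tiltP]) simp_all
qed

definition bellman :: "'u \<times> 'n \<Rightarrow> real ^ ('u \<times> 'n) \<Rightarrow> real ^ ('u \<times> 'n)" where
  "bellman x0 v = (\<chi> x. T (($) v) x - v $ x - v $ x0)"

text \<open>The Jacobian matrix of \<open>bellman x0\<close> at \<open>v\<close>; the column of ones
  at \<open>x0\<close> stems from the term \<open>v $ x0\<close>.\<close>

definition jac :: "'u \<times> 'n \<Rightarrow> real ^ ('u \<times> 'n) \<Rightarrow> real ^ ('u \<times> 'n) ^ ('u \<times> 'n)" where
  "jac x0 v = (\<chi> x y. tiltP (($) v) x y - (if x = y then 1 else 0) - (if y = x0 then 1 else 0))"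

lemma jac_mult:
  "(jac x0 v *v k) $ x = (\<Sum>y\<in>UNIV. tiltP (($) v) x y * k $ y) - k $ x - k $ x0"
proof -
  have "(jac x0 v *v k) $ x = (\<Sum>y\<in>UNIV. tiltP (($) v) x y * k $ y)
      - (\<Sum>y\<in>UNIV. if x = y then k $ y else 0) - (\<Sum>y\<in>UNIV. if y = x0 then k $ y else 0)"
    unfolding sum_subtractf[symmetric] matrix_vector_mult_def jac_def
    by (simp, intro sum.cong) (auto simp: left_diff_distrib)
  then show ?thesis by simp
qed

text \<open>A kernel vector \<open>k\<close> is harmonic for the tilted chain up to the constant
  \<open>k $ x0\<close>. That constant must vanish and \<open>k\<close> must be constant, hence
  \<open>k = 0\<close>.\<close>

lemma det_jac: "det (jac x0 v) \<noteq> 0"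
proof -
  have "k = 0" if "jac x0 v *v k = 0" for k
  proof -
    have *: "(\<Sum>y\<in>UNIV. tiltP (($) v) x y * k $ y) = k $ x + k $ x0" for x
      using jac_mult[of x0 v k x] that by simp
    show ?thesis
      using harmonic_up_to_const[of "($) v" "($) k", OF *] by (metis vec_eq_iff zero_index)
  qed
  then show ?thesis
    unfolding invertible_det_nz[symmetric] invertible_left_inverse matrix_left_invertible_ker by blast
qed

lemma inj_bellman: "inj (bellman x0)"
proof (rule injI)
  fix v w assume eq: "bellman x0 v = bellman x0 w"
  have T: "T (($) v) x = T (($) w) x + (v $ x - w $ x) + (v $ x0 - w $ x0)" for x
    using arg_cong[OF eq, of "\<lambda>z. z $ x"] by (simp add: bellman_def)
  \<comment> \<open>At a minimiser \<open>z\<close> of \<open>b - a\<close>, convexity gives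
    \<open>T b z - T a z \<ge> b $ z - a $ z\<close>, and the assumed identity leaves the difference
    at \<open>x0\<close>. Using both orders gives \<open>v $ x0 = w $ x0\<close>; then
    \<open>v - w\<close> is superharmonic and hence constant.\<close>
  have ge: "0 \<le> b $ x0 - a $ x0"
    if "\<And>x. T (($) b) x = T (($) a) x + (b $ x - a $ x) + (b $ x0 - a $ x0)"
    for a b :: "real ^ ('u \<times> 'n)"
  proof -
    obtain z where z: "\<And>x. b $ z - a $ z \<le> b $ x - a $ x"
      using finite_argmin[of "\<lambda>x. b $ x - a $ x"] by blast
    show ?thesis
      using T_convex[of "($) a" z "($) b"]
        stochastic_mean_ge[OF tiltP_stochastic, of "b $ z - a $ z"
          "\<lambda>x. b $ x - a $ x" "($) a" z]
        that[of z] z by simp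
  qed
  have x0: "v $ x0 = w $ x0"
    using ge[of v w] ge[of w v] T by (force simp: algebra_simps)
  have "v $ x - w $ x = v $ x0 - w $ x0" for x
  proof (rule irreducible_superharmonic_const[OF irreducible P0_nonneg tiltP_stochastic P0_nonzero_imp_tiltP])
    show "(\<Sum>y\<in>UNIV. tiltP (($) w) x y * (v $ y - w $ y)) \<le> v $ x - w $ x" for x
      using T_convex[of "($) w" x "($) v"] T[of x] x0 by simp
  qed
  then show "v = w"
    using x0 by (simp add: vec_eq_iff)
qed

text \<open>The oscillation of \<open>v\<close> is controlled because \<open>g = v - min v\<close> satisfies \<open>P\<^sub>0 g \<le> g + 2 B\<close>: iterating
  along a path from the minimiser to \<open>y\<close> bounds \<open>g y\<close>.\<close>

lemma bellman_coercive:
  obtains C where "0 \<le> C"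
    "\<And>v B y. (\<And>x. \<bar>bellman x0 v $ x\<bar> \<le> B) \<Longrightarrow> \<bar>v $ y\<bar> \<le> C * B"
proof -
  have "\<forall>x y. \<exists>n. 0 < nstep P0 n x y"
    using irreducible unfolding irreducible_chain_def by blast
  then obtain N where N: "\<And>x y. 0 < nstep P0 (N x y) x y" by metis
  \<comment> \<open>The sum over all pairs is a convenient single constant dominating every ratio of
    path length to path probability.\<close>
  define K where "K = (\<Sum>x\<in>UNIV. \<Sum>y\<in>UNIV. real (N x y) / nstep P0 (N x y) x y)"
  have K_nonneg: "0 \<le> K"
    using N by (auto simp: K_def intro!: sum_nonneg divide_nonneg_pos)
  have K: "real (N x y) / nstep P0 (N x y) x y \<le> K" for x y
  proof -
    have pos: "0 \<le> real (N x y) / nstep P0 (N x y) x y" for x y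
      using N[of x y] by simp
    have "real (N x y) / nstep P0 (N x y) x y \<le> (\<Sum>y\<in>UNIV. real (N x y) / nstep P0 (N x y) x y)"
      by (rule member_le_sum[of y]) (auto simp: pos)
    also have "\<dots> \<le> K"
      unfolding K_def
      by (rule member_le_sum[of x _ "\<lambda>x. \<Sum>y\<in>UNIV. real (N x y) / nstep P0 (N x y) x y"])
        (auto intro!: sum_nonneg pos)
    finally show ?thesis .
  qed
  have bound: "\<bar>v $ y\<bar> \<le> (1 + 2 * K) * B" if B: "\<And>x. \<bar>bellman x0 v $ x\<bar> \<le> B" for v B y
  proof -
    \<comment> \<open>Tangent planes at \<open>0\<close>, where \<open>T\<close> vanishes with
      gradient \<open>P0\<close>, and at \<open>v\<close> bracket \<open>T v\<close> between two
      averages of \<open>v\<close>.\<close>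
    have T_ge: "(\<Sum>y\<in>UNIV. P0 x y * v $ y) \<le> T (($) v) x" for x
      using T_convex[of "\<lambda>_. 0" x "($) v"] by (simp add: T_zero tiltP_zero)
    have T_le: "T (($) v) x \<le> (\<Sum>y\<in>UNIV. tiltP (($) v) x y * v $ y)" for x
      using T_convex[of "($) v" x "\<lambda>_. 0"] by (simp add: T_zero sum_negf)
    have T_B: "\<bar>T (($) v) x - v $ x - v $ x0\<bar> \<le> B" for x
      using B[of x] by (simp add: bellman_def)
    obtain a where a: "\<And>x. v $ a \<le> v $ x" using finite_argmin[of "($) v"] by blast
    obtain b where b: "\<And>x. v $ x \<le> v $ b" using finite_argmax[of "($) v"] by blast
    \<comment> \<open>So \<open>T v - v\<close> is nonnegative at a minimiser and nonpositive at a
      maximiser, which bounds \<open>v $ x0\<close> from both sides.\<close>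
    have "v $ a \<le> T (($) v) a"
      using T_ge[of a] stochastic_mean_ge[OF P0_stochastic, of "v $ a" "($) v" a] a by simp
    moreover have "T (($) v) b \<le> v $ b"
      using T_le[of b] stochastic_mean_le[OF tiltP_stochastic, of "($) v" "v $ b" "($) v" b] b by simp
    ultimately have x0: "\<bar>v $ x0\<bar> \<le> B"
      using T_B[of a] T_B[of b] by linarith
    have B0: "0 \<le> B" using x0 by linarith
    define g where "g z = v $ z - v $ a" for z
    have g_nonneg: "0 \<le> g z" for z
      using a by (simp add: g_def)
    have g_step: "(\<Sum>z\<in>UNIV. P0 x z * g z) \<le> g x + 2 * B" for x
    proof -
      have "(\<Sum>z\<in>UNIV. P0 x z * g z) = (\<Sum>z\<in>UNIV. P0 x z * v $ z) - v $ a"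
        by (simp add: g_def right_diff_distrib sum_subtractf stochastic_sum[OF P0_stochastic]
            flip: sum_distrib_right)
      then show ?thesis
        using T_ge[of x] T_B[of x] x0 by (simp add: g_def)
    qed
    have g_le: "g z \<le> 2 * K * B" for z
    proof -
      have "nstep P0 (N a z) a z * g z \<le> (\<Sum>y\<in>UNIV. nstep P0 (N a z) a y * g y)"
        by (rule member_le_sum[of z]) (auto intro!: mult_nonneg_nonneg nstep_nonneg P0_nonneg g_nonneg)
      also have "\<dots> \<le> g a + real (N a z) * (2 * B)"
        by (rule nstep_mean_le[OF P0_stochastic g_step])
      finally have "nstep P0 (N a z) a z * g z \<le> real (N a z) * (2 * B)"
        by (simp add: g_def)
      then have "g z \<le> (real (N a z) / nstep P0 (N a z) a z) * (2 * B)"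
        using N[of a z] by (simp add: field_simps)
      also have "\<dots> \<le> K * (2 * B)"
        by (intro mult_right_mono K) (use B0 in simp)
      finally show ?thesis by simp
    qed
    have "\<bar>v $ y - v $ x0\<bar> \<le> 2 * K * B"
      using g_le[of y] g_le[of x0] g_nonneg[of y] g_nonneg[of x0] by (simp add: g_def)
    then show ?thesis
      using x0 by (simp add: distrib_right)
  qed
  show thesis
    using that[of "1 + 2 * K"] K_nonneg bound by simp
qed

section \<open>Differentiability and surjectivity of \<open>bellman\<close>\<close>

lemma has_derivative_T:
  "((\<lambda>v. T (($) v) x) has_derivative (\<lambda>k. \<Sum>y\<in>UNIV. tiltP (($) v) x y * k $ y)) (at v)"
proof -
  define Z where "Z v = (\<Sum>y\<in>UNIV. P0 x y * exp (cond_h Q0 (($) v) x (fst y)))"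
    for v :: "real ^ ('u \<times> 'n)"
  have Z: "0 < Z v" "T (($) v) x = ln (Z v)" for v
    using partition_pos[of x "($) v"] by (simp_all add: Z_def Lambda_def)
  have cond: "((\<lambda>v. cond_h Q0 (($) v) x u) has_derivative (\<lambda>k. cond_h Q0 (($) k) x u)) (at v)" for u
    unfolding cond_h_def by (intro derivative_intros has_derivative_vec_nth)
  \<comment> \<open>The gradient of log-sum-exp consists of the normalised weights, here the tilted
    row acting on \<open>cond_h\<close> of the direction \<open>k\<close>;
    \<open>sum_transition_cond_h\<close> then restores \<open>k\<close> itself.\<close>
  have "((\<lambda>v. ln (Z v)) has_derivative (\<lambda>k. (\<Sum>y\<in>UNIV.
      P0 x y * (cond_h Q0 (($) k) x (fst y) * exp (cond_h Q0 (($) v) x (fst y)))) * inverse (Z v))) (at v)"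
    using Z(1)[of v] unfolding Z_def by (auto intro!: derivative_eq_intros cond simp: field_simps)
  also have "(\<lambda>k. (\<Sum>y\<in>UNIV.
      P0 x y * (cond_h Q0 (($) k) x (fst y) * exp (cond_h Q0 (($) v) x (fst y)))) * inverse (Z v))
    = (\<lambda>k. \<Sum>y\<in>UNIV. tiltP (($) v) x y * cond_h Q0 (($) k) x (fst y))"
    using Z(1)[of v] by (auto simp: tiltP_eq Z(2) exp_diff sum_distrib_left divide_inverse mult_ac)
  finally show ?thesis
    by (simp add: Z(2) sum_transition_cond_h)
qed

lemma has_derivative_bellman: "(bellman x0 has_derivative (*v) (jac x0 v)) (at v)"
  by (rule has_derivative_vecI)
    (auto simp: bellman_def jac_mult intro!: has_derivative_diff has_derivative_T has_derivative_vec_nth)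

lemma continuous_on_bellman: "continuous_on S (bellman x0)"
  by (meson has_derivative_bellman has_derivative_continuous continuous_at_imp_continuous_on)

lemma surj_bellman: "surj (bellman x0)"
proof -
  have "open (range (bellman x0))"
    by (intro invariance_of_domain continuous_on_bellman inj_bellman) simp
  moreover have "closed (range (bellman x0))"
    unfolding closed_sequential_limits
  proof (intro allI impI, elim conjE)
    fix s l assume s: "\<forall>n. s n \<in> range (bellman x0)" and l: "s \<longlonglongrightarrow> l"
    obtain C where C: "0 \<le> C"
      "\<And>v B y. (\<And>x. \<bar>bellman x0 v $ x\<bar> \<le> B) \<Longrightarrow> \<bar>v $ y\<bar> \<le> C * B"
      using bellman_coercive[of x0] by metis
    obtain B where B: "\<And>n. norm (s n) \<le> B"
      using l convergent_imp_bounded[OF l] by (auto simp: bounded_iff)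
    \<comment> \<open>Each coordinate of a preimage is at most \<open>C * B\<close>, and the norm is
      at most the sum of the absolute coordinates. The sequence thus lies in the image of one
      compact ball, which is closed.\<close>
    define R where "R = real CARD('u \<times> 'n) * (C * B)"
    have "s n \<in> bellman x0 ` cball 0 R" for n
    proof -
      obtain v where v: "s n = bellman x0 v" using s by blast
      have "\<bar>bellman x0 v $ x\<bar> \<le> B" for x
        using component_le_norm_cart[of "s n" x] B[of n] v by simp
      then have "\<bar>v $ y\<bar> \<le> C * B" for y by (rule C)
      then have "(\<Sum>y\<in>UNIV. \<bar>v $ y\<bar>) \<le> R"
        using sum_bounded_above[of UNIV "\<lambda>y. \<bar>v $ y\<bar>" "C * B"] by (simp add: R_def)
      then show ?thesis
        using norm_le_l1_cart[of v] v by auto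
    qed
    moreover have "closed (bellman x0 ` cball 0 R)"
      by (intro compact_imp_closed compact_continuous_image continuous_on_bellman compact_cball)
    ultimately have "l \<in> bellman x0 ` cball 0 R"
      using l closed_sequentially by blast
    then show "l \<in> range (bellman x0)" by blast
  qed
  ultimately show ?thesis
    using clopen[of "range (bellman x0)"] by auto
qed

section \<open>The invariant pmf of the tilted chain by Cramer's rule\<close>

lemma transpose_jac_mult:
  "(transpose (jac x0 v) *v m) $ y =
    (\<Sum>x\<in>UNIV. m $ x * tiltP (($) v) x y) - m $ y - (if y = x0 then \<Sum>x\<in>UNIV. m $ x else 0)"
proof -
  have "(transpose (jac x0 v) *v m) $ y = (\<Sum>x\<in>UNIV. m $ x * tiltP (($) v) x y)
      - (\<Sum>x\<in>UNIV. if x = y then m $ x else 0) - (\<Sum>x\<in>UNIV. if y = x0 then m $ x else 0)"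
    unfolding sum_subtractf[symmetric] matrix_vector_mult_def vec_lambda_beta
    by (intro sum.cong) (auto simp: left_diff_distrib transpose_def jac_def)
  then show ?thesis by simp
qed

text \<open>Cramer's solution of the transposed system, whose right-hand side forces total mass one and with
  it invariance. It is nonnegative because its normalised absolute value solves the same system.\<close>

definition inv_vec :: "'u \<times> 'n \<Rightarrow> real ^ ('u \<times> 'n) \<Rightarrow> real ^ ('u \<times> 'n)" where
  "inv_vec x0 v = (\<chi> k. det (\<chi> i j. if j = k then - (if i = x0 then 1 else 0)
     else transpose (jac x0 v) $ i $ j) / det (jac x0 v))"

lemma inv_vec_iff:
  "transpose (jac x0 v) *v m = (\<chi> i. - (if i = x0 then 1 else 0)) \<longleftrightarrow> m = inv_vec x0 v"
  using cramer[of "transpose (jac x0 v)" m "\<chi> i. - (if i = x0 then 1 else 0)"] det_jac[of x0 v]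
  by (simp add: inv_vec_def cong: if_cong)

lemma invariant_pmf_inv_vec: "invariant_pmf (tiltP (($) v)) (($) (inv_vec x0 v))"
proof -
  let ?m = "inv_vec x0 v" and ?P = "tiltP (($) v)"
  have eq: "(\<Sum>x\<in>UNIV. ?m $ x * ?P x y) - ?m $ y - (if y = x0 then \<Sum>x\<in>UNIV. ?m $ x else 0)
      = - (if y = x0 then 1 else 0)" for y
    using inv_vec_iff[of x0 v ?m] transpose_jac_mult[of x0 v ?m y] by simp
  \<comment> \<open>When the system is summed over \<open>y\<close>, its first two terms cancel
    because tilted rows have mass one; what remains equates the total mass with one.\<close>
  have total: "(\<Sum>x\<in>UNIV. ?m $ x) = 1"
  proof -
    have "(\<Sum>y\<in>UNIV. (\<Sum>x\<in>UNIV. ?m $ x * ?P x y) - ?m $ y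
        - (if y = x0 then \<Sum>x\<in>UNIV. ?m $ x else 0)) = (\<Sum>y\<in>UNIV. - (if y = x0 then 1 else 0))"
      by (intro sum.cong refl eq)
    moreover have "(\<Sum>y\<in>UNIV. \<Sum>x\<in>UNIV. ?m $ x * ?P x y) = (\<Sum>x\<in>UNIV. ?m $ x)"
      by (subst sum.swap) (simp add: tiltP_sum flip: sum_distrib_left)
    ultimately show ?thesis
      by (simp add: sum_subtractf sum_negf)
  qed
  then have inv: "(\<Sum>x\<in>UNIV. ?m $ x * ?P x y) = ?m $ y" for y
    using eq[of y] by (auto split: if_splits)
  define c where "c = (\<Sum>x\<in>UNIV. \<bar>?m $ x\<bar>)"
  have c: "1 \<le> c"
    using sum_abs[of "($) ?m" UNIV] total by (simp add: c_def)
  have inv_abs: "(\<Sum>x\<in>UNIV. \<bar>?m $ x\<bar> * ?P x y) = \<bar>?m $ y\<bar>" for y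
    by (rule signed_invariant_abs[OF tiltP_stochastic inv])
  let ?a = "\<chi> x. \<bar>?m $ x\<bar> / c"
  have "transpose (jac x0 v) *v ?a = (\<chi> i. - (if i = x0 then 1 else 0))"
    using c inv_abs unfolding vec_eq_iff transpose_jac_mult
    by (auto simp: c_def simp flip: sum_divide_distrib)
  then have "?a = ?m"
    unfolding inv_vec_iff .
  then have "?m $ x = \<bar>?m $ x\<bar> / c" for x
    by (metis vec_lambda_beta)
  then have "0 \<le> ?m $ x" for x
    using c by (metis abs_ge_zero divide_nonneg_nonneg order_trans zero_le_one)
  then show ?thesis
    using total inv by (auto simp: invariant_pmf_def is_pmf_def)
qed

section \<open>The solution curve and its smoothness in \<zeta>\<close>

definition optimal_curve :: "'u \<times> 'n \<Rightarrow> ('u \<times> 'n \<Rightarrow> real) \<Rightarrow> real \<Rightarrow> real ^ ('u \<times> 'n)" where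
  "optimal_curve x0 U \<zeta> = inv (bellman x0) (\<zeta> *\<^sub>R (\<chi> x. - U x))"

lemma bellman_optimal_curve: "bellman x0 (optimal_curve x0 U \<zeta>) = \<zeta> *\<^sub>R (\<chi> x. - U x)"
  unfolding optimal_curve_def by (rule surj_f_inv_f[OF surj_bellman])

lemma T_optimal_curve:
  "T (($) (optimal_curve x0 U \<zeta>)) x
    = optimal_curve x0 U \<zeta> $ x + optimal_curve x0 U \<zeta> $ x0 - \<zeta> * U x"
  using arg_cong[OF bellman_optimal_curve[of x0 U \<zeta>], of "\<lambda>z. z $ x"] by (simp add: bellman_def)

text \<open>Cramer's solution \<open>k\<close> of \<open>jac x0 v *v k = - U\<close>, the equation
  obtained by differentiating \<open>bellman x0 v = - \<zeta> U\<close> in \<zeta>.\<close>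

definition velocity :: "'u \<times> 'n \<Rightarrow> ('u \<times> 'n \<Rightarrow> real) \<Rightarrow> real ^ ('u \<times> 'n) \<Rightarrow> real ^ ('u \<times> 'n)" where
  "velocity x0 U v = (\<chi> k. det (\<chi> i j. if j = k then - U i else jac x0 v $ i $ j) / det (jac x0 v))"

lemma has_vector_derivative_optimal_curve:
  "(optimal_curve x0 U has_vector_derivative velocity x0 U (optimal_curve x0 U \<zeta>)) (at \<zeta>)"
proof -
  let ?b = "\<chi> x. - U x" and ?G = "inv (bellman x0)" and ?v = "optimal_curve x0 U \<zeta>"
  let ?J = "jac x0 ?v"
  obtain K where J: "?J ** K = mat 1"
    using det_jac[of x0 ?v] unfolding invertible_det_nz[symmetric] invertible_def by blast
  have "(?G has_derivative (*v) K) (at (bellman x0 ?v))"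
  proof (rule has_derivative_inverse_strong[where S = UNIV and f = "bellman x0" and x = ?v and f' = "(*v) ?J"])
    show "continuous_on UNIV (bellman x0)" by (rule continuous_on_bellman)
    show "(bellman x0 has_derivative (*v) ?J) (at ?v)" by (rule has_derivative_bellman)
    show "(*v) ?J \<circ> (*v) K = id"
      by (auto simp: fun_eq_iff matrix_vector_mul_assoc J)
  qed (auto simp: inj_bellman)
  then have G: "(?G has_derivative (*v) K) (at (\<zeta> *\<^sub>R ?b))"
    by (simp add: bellman_optimal_curve)
  have "((\<lambda>\<zeta>. \<zeta> *\<^sub>R ?b) has_derivative (\<lambda>t. t *\<^sub>R ?b)) (at \<zeta>)"
    by (auto intro!: derivative_eq_intros)
  from has_derivative_compose[OF this G]
  have "(optimal_curve x0 U has_derivative (\<lambda>t. t *\<^sub>R (K *v ?b))) (at \<zeta>)"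
    by (simp add: optimal_curve_def[abs_def] matrix_vector_mult_scaleR)
  moreover have "?J *v (K *v ?b) = ?b"
    by (simp add: matrix_vector_mul_assoc J)
  \<comment> \<open>The inverse matrix \<open>K\<close> is only known to exist at each \<zeta>.
    Cramer's formula makes the dependence on \<open>v\<close> explicit, from which continuity can be
    read off.\<close>
  then have "K *v ?b = velocity x0 U ?v"
    using cramer[OF det_jac[of x0 ?v], of "K *v ?b" ?b] by (simp add: velocity_def cong: if_cong)
  ultimately show ?thesis
    by (simp add: has_vector_derivative_def)
qed

text \<open>A bootstrap: the curve is differentiable, hence continuous, hence so are the Jacobian
  entries along it, and hence its velocity.\<close>

lemma C1_optimal_curve: "(\<lambda>\<zeta>. optimal_curve x0 U \<zeta> $ x) C1_differentiable_on UNIV"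
proof -
  have optimal_curve: "continuous_on UNIV (optimal_curve x0 U)"
    by (meson has_vector_derivative_optimal_curve has_vector_derivative_continuous
        continuous_at_imp_continuous_on)
  have "continuous_on UNIV (\<lambda>\<zeta>. tiltP (($) (optimal_curve x0 U \<zeta>)) x y)" for x y
    \<comment> \<open>Along the curve the equation itself expresses \<open>T\<close> by coordinates
      of the curve and \<zeta>, so the logarithm disappears.\<close>
    unfolding tiltP_eq T_optimal_curve cond_h_def by (intro continuous_intros optimal_curve)
  then have jac: "continuous_on UNIV (\<lambda>\<zeta>. jac x0 (optimal_curve x0 U \<zeta>) $ i $ j)" for i j
    unfolding jac_def vec_lambda_beta by (intro continuous_intros)
  have "continuous_on UNIV (\<lambda>\<zeta>. velocity x0 U (optimal_curve x0 U \<zeta>) $ x)" for x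
    unfolding velocity_def vec_lambda_beta
  proof (intro continuous_on_divide continuous_on_det jac)
    show "continuous_on UNIV (\<lambda>\<zeta>. (\<chi> i j. if j = x then - U i
        else jac x0 (optimal_curve x0 U \<zeta>) $ i $ j) $ i $ j)" for i j
      using jac by (cases "j = x") simp_all
  qed (simp add: det_jac)
  then show ?thesis
    unfolding C1_differentiable_on_def
    by (intro exI[of _ "\<lambda>\<zeta>. velocity x0 U (optimal_curve x0 U \<zeta>) $ x"] conjI ballI
        bounded_linear.has_vector_derivative[OF bounded_linear_vec_nth]
        has_vector_derivative_optimal_curve)
qed

lemma C1_tiltP_optimal_curve:
  "(\<lambda>\<zeta>. tiltP (($) (optimal_curve x0 U \<zeta>)) x y) C1_differentiable_on UNIV"
  unfolding tiltP_eq T_optimal_curve cond_h_def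
  by (intro C1_differentiable_on_mult C1_differentiable_on_exp C1_differentiable_on_diff
      C1_differentiable_on_add C1_differentiable_on_sum C1_optimal_curve C1_differentiable_on_const
      C1_differentiable_on_ident)

lemma C1_inv_vec_optimal_curve:
  "(\<lambda>\<zeta>. inv_vec x0 (optimal_curve x0 U \<zeta>) $ x) C1_differentiable_on UNIV"
proof -
  have jac: "(\<lambda>\<zeta>. jac x0 (optimal_curve x0 U \<zeta>) $ i $ j) C1_differentiable_on UNIV" for i j
    unfolding jac_def vec_lambda_beta
    by (intro C1_differentiable_on_diff C1_tiltP_optimal_curve C1_differentiable_on_const)
  show ?thesis
    unfolding inv_vec_def vec_lambda_beta
  proof (intro C1_differentiable_on_divide C1_differentiable_on_det jac)
    show "(\<lambda>\<zeta>. (\<chi> i j. if j = x then - (if i = x0 then 1 else 0)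
        else transpose (jac x0 (optimal_curve x0 U \<zeta>)) $ i $ j) $ i $ j)
        C1_differentiable_on UNIV" for i j
      using jac by (cases "j = x") (simp_all add: transpose_def)
  qed (simp add: det_jac)
qed

end

section \<open>The optimal family\<close>

theorem theorem3p4:
  fixes Q0 :: "'u::finite \<times> 'n::finite \<Rightarrow> 'n \<Rightarrow> real"
    and R0 :: "'u \<times> 'n \<Rightarrow> 'u \<Rightarrow> real"
    and P0 :: "'u \<times> 'n \<Rightarrow> 'u \<times> 'n \<Rightarrow> real"
    and U :: "'u \<times> 'n \<Rightarrow> real"
    and x0 :: "'u \<times> 'n"
  assumes "stochastic Q0"
    and "stochastic R0"
    and "P0 = transition Q0 R0"
    and "irreducible_chain P0"
    and "aperiodic_chain P0"
  shows "\<exists>(\<pi> :: real \<Rightarrow> 'u \<times> 'n \<Rightarrow> real) (P :: real \<Rightarrow> 'u \<times> 'n \<Rightarrow> 'u \<times> 'n \<Rightarrow> real)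
           (h :: real \<Rightarrow> 'u \<times> 'n \<Rightarrow> real) (\<eta> :: real \<Rightarrow> real).
      (\<forall>\<zeta>. is_arg_max (DV_objective U P0 \<zeta>)
             (\<lambda>(\<pi>', P'). admissible Q0 P' \<and> invariant_pmf P' \<pi>') (\<pi> \<zeta>, P \<zeta>))
    \<and> (\<forall>\<zeta>. h \<zeta> x0 = 0 \<and> AROE Q0 R0 U \<zeta> (h \<zeta>) (\<eta> \<zeta>))
    \<and> (\<forall>\<zeta> x x'. P \<zeta> x x' =
          P0 x x' * exp (cond_h Q0 (h \<zeta>) x (fst x') - Lambda Q0 P0 (h \<zeta>) x))
    \<and> (\<forall>x. (\<lambda>\<zeta>. \<pi> \<zeta> x) C1_differentiable_on UNIV)
    \<and> (\<forall>x x'. (\<lambda>\<zeta>. P \<zeta> x x') C1_differentiable_on UNIV)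
    \<and> (\<forall>x. (\<lambda>\<zeta>. h \<zeta> x) C1_differentiable_on UNIV)
    \<and> \<eta> C1_differentiable_on UNIV"
proof -
  interpret controlled_chain Q0 R0 P0
    by unfold_locales fact+
  define v where "v = optimal_curve x0 U"
  \<comment> \<open>The curve carries both unknowns: its value at \<open>x0\<close> is
    \<open>\<eta>\<close>, and subtracting that constant restores the normalisation
    \<open>h \<zeta> x0 = 0\<close>.\<close>
  define h where "h \<zeta> = (\<lambda>x. v \<zeta> $ x - v \<zeta> $ x0)" for \<zeta>
  define \<eta> where "\<eta> \<zeta> = v \<zeta> $ x0" for \<zeta>
  have fp: "\<zeta> * U x + T (h \<zeta>) x = h \<zeta> x + \<eta> \<zeta>" for \<zeta> x
    unfolding h_def T_shift by (simp add: \<eta>_def v_def T_optimal_curve)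
  \<comment> \<open>A constant shifts \<open>cond_h\<close> and \<open>T\<close> equally and cancels
    in the exponent.\<close>
  have tiltP_h: "tiltP (h \<zeta>) = tiltP (($) (v \<zeta>))" for \<zeta>
    by (intro ext) (simp add: tiltP_eq h_def T_shift cond_h_shift)
  define \<pi> where "\<pi> \<zeta> = ($) (inv_vec x0 (v \<zeta>))" for \<zeta>
  have \<pi>: "invariant_pmf (tiltP (h \<zeta>)) (\<pi> \<zeta>)" for \<zeta>
    unfolding tiltP_h \<pi>_def by (rule invariant_pmf_inv_vec)
  have adm: "admissible Q0 (tiltP (h \<zeta>))" for \<zeta>
    unfolding admissible_def using tilt_stochastic by blast
  have opt: "is_arg_max (DV_objective U P0 \<zeta>)
      (\<lambda>(\<pi>', P'). admissible Q0 P' \<and> invariant_pmf P' \<pi>') (\<pi> \<zeta>, tiltP (h \<zeta>))" for \<zeta>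
    using DV_objective_le[OF fp] DV_objective_tiltP[OF fp \<pi>, of \<zeta>] \<pi> adm
    by (auto simp: is_arg_max_def not_less)
  show ?thesis
  proof (rule exI[of _ \<pi>], rule exI[of _ "\<lambda>\<zeta>. tiltP (h \<zeta>)"], rule exI[of _ h], rule exI[of _ \<eta>],
      intro conjI allI)
    show "is_arg_max (DV_objective U P0 \<zeta>)
      (\<lambda>(\<pi>', P'). admissible Q0 P' \<and> invariant_pmf P' \<pi>') (\<pi> \<zeta>, tiltP (h \<zeta>))" for \<zeta>
      by (rule opt)
    show "AROE Q0 R0 U \<zeta> (h \<zeta>) (\<eta> \<zeta>)" for \<zeta>
      by (rule AROE_of_fixed_point) (rule fp)
    show "tiltP (h \<zeta>) x x' = P0 x x' * exp (cond_h Q0 (h \<zeta>) x (fst x') - T (h \<zeta>) x)" for \<zeta> x x'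
      by (rule tiltP_eq)
    show "h \<zeta> x0 = 0" for \<zeta> by (simp add: h_def)
    show "(\<lambda>\<zeta>. \<pi> \<zeta> x) C1_differentiable_on UNIV" for x
      unfolding \<pi>_def v_def by (rule C1_inv_vec_optimal_curve)
    show "(\<lambda>\<zeta>. tiltP (h \<zeta>) x x') C1_differentiable_on UNIV" for x x'
      unfolding tiltP_h v_def by (rule C1_tiltP_optimal_curve)
    show "(\<lambda>\<zeta>. h \<zeta> x) C1_differentiable_on UNIV" for x
      unfolding h_def v_def by (intro C1_differentiable_on_diff C1_optimal_curve)
    show "\<eta> C1_differentiable_on UNIV"
      unfolding \<eta>_def[abs_def] v_def by (rule C1_optimal_curve)
  qed
qed

end
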